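(* Let $X,Y$ be complex Banach spaces and let $A\in\mathcal{L}(X,Y)$ and $B,C\in\mathcal{L}(Y,X)$ be such that $A(BA)^2=ABACA=ACABA=(AC)^2A$. Then: i) $AC-I$ is upper semi-Fredholm if and only if $BA-I$ is upper semi-Fredholm; ii) $AC-I$ is lower semi-Fredholm if and only if $BA-I$ is lower semi-Fredholm. In other words, $$\sigma_{uf}(AC)\setminus\{0\}=\sigma_{uf}(BA)\setminus\{0\}\quad\text{and}\quad\sigma_{lf}(AC)\setminus\{0\}=\sigma_{lf}(BA)\setminus\{0\}.$$
   Context: $\mathcal{L}(X,Y)$ is the set of bounded linear operators from $X$ to $Y$, and $\mathcal{L}(X)=\mathcal{L}(X,X)$. For $T\in\mathcal{L}(X)$ with null space $\mathcal{N}(T)$ and range $\mathcal{R}(T)$: $T$ is upper semi-Fredholm if $\mathcal{R}(T)$ is closed and $\dim\mathcal{N}(T)<\infty$; $T$ is lower semi-Fredholm if the codimension of $\mathcal{R}(T)$ in $X$ is finite. $\sigma_{uf}(T)=\{\lambda\in\mathbb{C}: T-\lambda\text{ is not upper semi-Fredholm}\}$ and $\sigma_{lf}(T)=\{\lambda\in\mathbb{C}: T-\lambda\text{ is not lower semi-Fredholm}\}$. *)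

theory Defs
  imports "HOL-Analysis.Analysis"
begin

section \<open>Complex Banach spaces\<close>

text \<open>HOL-Analysis only has real Banach spaces. A complex Banach space is a Banach space whose
  scalar multiplication extends to the complex numbers, with an absolutely homogeneous norm.\<close>

class scaleC =
  fixes scaleC :: "complex \<Rightarrow> 'a \<Rightarrow> 'a"  (infixr \<open>*\<^sub>C\<close> 75)

class complex_vector = real_vector + scaleC +
  assumes scaleC_add_right: "a *\<^sub>C (x + y) = a *\<^sub>C x + a *\<^sub>C y"
    and scaleC_add_left: "(a + b) *\<^sub>C x = a *\<^sub>C x + b *\<^sub>C x"
    and scaleC_scaleC: "a *\<^sub>C (b *\<^sub>C x) = (a * b) *\<^sub>C x"
    and scaleC_of_real: "complex_of_real r *\<^sub>C x = r *\<^sub>R x"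

class complex_banach = complex_vector + banach +
  assumes norm_scaleC: "norm (a *\<^sub>C x) = cmod a * norm x"

instantiation complex :: complex_banach
begin

definition scaleC_complex :: "complex \<Rightarrow> complex \<Rightarrow> complex"
  where "scaleC_complex a x = a * x"

instance
  by standard (auto simp: scaleC_complex_def algebra_simps norm_mult scaleR_conv_of_real)

end

global_interpretation complex_vector: vector_space "scaleC :: complex \<Rightarrow> 'a \<Rightarrow> 'a::complex_vector"
  defines cspan = complex_vector.span
proof
  fix a b :: complex and x y :: 'a
  show "1 *\<^sub>C x = x"
    using scaleC_of_real[of 1 x] by simp
qed (simp_all add: scaleC_add_right scaleC_add_left scaleC_scaleC)

locale bounded_clinear = bounded_linear f
  for f :: "'a::complex_banach \<Rightarrow> 'b::complex_banach" +
  assumes scaleC: "f (c *\<^sub>C x) = c *\<^sub>C f x"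


section \<open>Semi-Fredholm operators\<close>

definition cfinite_dim :: "'a::complex_vector set \<Rightarrow> bool"
  where "cfinite_dim M \<longleftrightarrow> (\<exists>F. finite F \<and> cspan F = M)"

text \<open>The codimension of a subspace \<open>M\<close> is the dimension of the quotient space by \<open>M\<close>. It is
  finite iff the cosets of finitely many vectors span the quotient, that is, every \<open>x\<close> is congruent
  modulo \<open>M\<close> to a linear combination of these vectors.\<close>

definition cfinite_codim :: "'a::complex_vector set \<Rightarrow> bool"
  where "cfinite_codim M \<longleftrightarrow> (\<exists>F. finite F \<and> (\<forall>x. \<exists>y\<in>cspan F. x - y \<in> M))"

definition upper_semi_fredholm :: "('a::complex_banach \<Rightarrow> 'a) \<Rightarrow> bool"
  where "upper_semi_fredholm T \<longleftrightarrow>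
    bounded_clinear T \<and> closed (range T) \<and> cfinite_dim {x. T x = 0}"

definition lower_semi_fredholm :: "('a::complex_banach \<Rightarrow> 'a) \<Rightarrow> bool"
  where "lower_semi_fredholm T \<longleftrightarrow> bounded_clinear T \<and> cfinite_codim (range T)"

definition sigma_uf :: "('a::complex_banach \<Rightarrow> 'a) \<Rightarrow> complex set"
  where "sigma_uf T = {l. \<not> upper_semi_fredholm (\<lambda>x. T x - l *\<^sub>C x)}"

definition sigma_lf :: "('a::complex_banach \<Rightarrow> 'a) \<Rightarrow> complex set"
  where "sigma_lf T = {l. \<not> lower_semi_fredholm (\<lambda>x. T x - l *\<^sub>C x)}"

end

theory Submission
  imports Defs
begin

text \<open>
  Fix \<open>l \<noteq> 0\<close> and put \<open>S = BA - l\<close> and \<open>T = AC - l\<close>. The operators \<open>M = ACA\<close> and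
  \<open>N = BABAC\<close> intertwine \<open>S\<close> and \<open>T\<close>, that is, \<open>MS = TM\<close> and \<open>NT = SN\<close>, and the hypotheses
  collapse their products to powers: \<open>NM = (BA)^4\<close> and \<open>MN = (AC)^4\<close>. Modulo \<open>S\<close>, the operator
  \<open>BA\<close> is the scalar \<open>l\<close>, so \<open>NM\<close> is the invertible scalar \<open>l^4\<close> modulo \<open>S\<close>; likewise for
  \<open>MN\<close> modulo \<open>T\<close>. Thus \<open>M\<close> and \<open>N\<close> are mutually inverse, up to a nonzero scalar, both between
  the null spaces and between the cokernels of \<open>S\<close> and \<open>T\<close>. This settles the dimension and the
  codimension. Closedness of the range needs no dimension count: the range of \<open>S\<close> is the preimage
  under \<open>M\<close> of the range of \<open>T\<close>, and \<open>M\<close> is continuous.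

  The situation is symmetric in \<open>S\<close> and \<open>T\<close>, so one direction is proved abstractly in the locale
  \<open>intertwined\<close>, which is then interpreted twice. Working with every \<open>l \<noteq> 0\<close> at once gives the
  spectral equalities, and \<open>l = 1\<close> gives the two equivalences.
\<close>

lemma bounded_clinear_compose:
  assumes "bounded_clinear f" "bounded_clinear g"
  shows "bounded_clinear (\<lambda>x. f (g x))"
  using assms unfolding bounded_clinear_def bounded_clinear_axioms_def
  by (auto intro: bounded_linear_compose)

lemma bounded_clinear_scaleC: "bounded_clinear (\<lambda>x :: 'a::complex_banach. l *\<^sub>C x)"
proof
  show "\<exists>K. \<forall>x::'a. norm (l *\<^sub>C x) \<le> norm x * K"
    by (auto simp: norm_scaleC mult.commute
        intro!: exI[of _ "cmod l"])
  fix r :: real and x :: 'a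
  have "l *\<^sub>C (complex_of_real r *\<^sub>C x) = complex_of_real r *\<^sub>C (l *\<^sub>C x)"
    by (simp only: scaleC_scaleC mult.commute)
  then show "l *\<^sub>C (r *\<^sub>R x) = r *\<^sub>R l *\<^sub>C x"
    by (simp only: scaleC_of_real)
qed (simp_all add: scaleC_add_right scaleC_scaleC mult.commute)

lemma bounded_clinear_sub:
  assumes "bounded_clinear f" "bounded_clinear g"
  shows "bounded_clinear (\<lambda>x. f x - g x)"
  using assms unfolding bounded_clinear_def bounded_clinear_axioms_def
  by (auto intro: bounded_linear_sub simp: complex_vector.scale_right_diff_distrib)

lemma (in bounded_clinear) span_image: "cspan (f ` F) = f ` cspan F"
proof -
  interpret hom: module_hom "scaleC :: complex \<Rightarrow> 'a \<Rightarrow> 'a" "scaleC :: complex \<Rightarrow> 'b \<Rightarrow> 'b" f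
    by unfold_locales (simp_all add: add scaleC scaleC_add_right scaleC_add_left scaleC_scaleC)
  show ?thesis
    using hom.span_image[of F] unfolding cspan_def .
qed

text \<open>Since \<open>p^n - l^n\<close> is divisible by \<open>p - l\<close>, the operator \<open>P\<close> acts as the scalar \<open>l\<close>
  modulo the range of \<open>P - l\<close>. The induction builds up the value of the quotient polynomial at
  \<open>x\<close> as the witness \<open>w\<close>.\<close>

lemma funpow_eq_scalar_modulo_range:
  assumes "bounded_clinear P"
  shows "\<exists>w. (P ^^ n) x = l ^ n *\<^sub>C x + (P w - l *\<^sub>C w)"
proof -
  interpret P: bounded_clinear P by fact
  show ?thesis
  proof (induction n)
    case 0
    show ?case by (rule exI[of _ 0]) (simp add: P.zero)
  next
    case (Suc n)
    then obtain w where w: "(P ^^ n) x = l ^ n *\<^sub>C x + (P w - l *\<^sub>C w)" by blast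
    show ?case
      by (rule exI[of _ "l ^ n *\<^sub>C x + P w"])
        (simp add: w P.add P.diff P.scaleC scaleC_add_right scaleC_scaleC)
  qed
qed

lemma funpow_eigenvector:
  assumes "bounded_clinear P" and "P x = l *\<^sub>C x"
  shows "(P ^^ n) x = l ^ n *\<^sub>C x"
proof -
  interpret P: bounded_clinear P by fact
  show ?thesis
    by (induction n) (simp_all add: P.scaleC assms(2) scaleC_scaleC mult.commute)
qed

text \<open>This is one half of the symmetric situation: it carries properties of \<open>Q - l\<close> over to
  \<open>P - l\<close>, and exchanging the roles of \<open>P, M\<close> and \<open>Q, N\<close> gives the other half. The last
  assumption makes \<open>N M\<close> invertible modulo \<open>P - l\<close> whenever \<open>l \<noteq> 0\<close>.\<close>

locale intertwined =
  P: bounded_clinear P + Q: bounded_clinear Q + M: bounded_clinear M + N: bounded_clinear N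
  for P :: "'x::complex_banach \<Rightarrow> 'x" and Q :: "'y::complex_banach \<Rightarrow> 'y"
    and M :: "'x \<Rightarrow> 'y" and N :: "'y \<Rightarrow> 'x" +
  fixes n :: nat
  assumes M_P: "M (P x) = Q (M x)"
    and N_Q: "N (Q y) = P (N y)"
    and N_M: "N (M x) = (P ^^ n) x"
begin

lemma M_shift: "M (P x - l *\<^sub>C x) = Q (M x) - l *\<^sub>C M x"
  by (simp add: M.diff M.scaleC M_P)

lemma N_shift: "N (Q y - l *\<^sub>C y) = P (N y) - l *\<^sub>C N y"
  by (simp add: N.diff N.scaleC N_Q)

lemma eq_N_M_modulo_range:
  assumes "l \<noteq> 0"
  shows "\<exists>w. x = N (inverse (l ^ n) *\<^sub>C M x) + (P w - l *\<^sub>C w)"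
proof -
  obtain w where w: "N (M x) = l ^ n *\<^sub>C x + (P w - l *\<^sub>C w)"
    using funpow_eq_scalar_modulo_range[OF P.bounded_clinear_axioms] N_M by metis
  let ?v = "- (inverse (l ^ n) *\<^sub>C w)"
  have "x = N (inverse (l ^ n) *\<^sub>C M x) + (P ?v - l *\<^sub>C ?v)"
    using assms by (simp add: N.scaleC w P.neg P.scaleC scaleC_add_right scaleC_scaleC
        complex_vector.scale_right_diff_distrib mult.commute)
  then show ?thesis ..
qed

text \<open>On the null space of \<open>P - l\<close> the product \<open>N M\<close> is exactly the scalar \<open>l^n\<close>, so a null vector
  is recovered from its image under \<open>M\<close>, which is a null vector of \<open>Q - l\<close>.\<close>

lemma null_space_shift:
  assumes "l \<noteq> 0"
  shows "{x. P x - l *\<^sub>C x = 0} = N ` {y. Q y - l *\<^sub>C y = 0}"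
proof (intro equalityI subsetI)
  fix x assume "x \<in> {x. P x - l *\<^sub>C x = 0}"
  then have x: "P x - l *\<^sub>C x = 0" by simp
  let ?y = "inverse (l ^ n) *\<^sub>C M x"
  have "Q (M x) = l *\<^sub>C M x"
    using M_shift[of x l] x by (simp add: M.zero)
  then have "Q ?y - l *\<^sub>C ?y = 0"
    by (simp add: Q.scaleC scaleC_scaleC mult.commute)
  moreover have "x = N ?y"
    using funpow_eigenvector[OF P.bounded_clinear_axioms, of x l n] x assms
    by (simp add: N.scaleC N_M scaleC_scaleC)
  ultimately show "x \<in> N ` {y. Q y - l *\<^sub>C y = 0}" by blast
next
  fix x assume "x \<in> N ` {y. Q y - l *\<^sub>C y = 0}"
  then obtain y where "x = N y" "Q y - l *\<^sub>C y = 0" by blast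
  then show "x \<in> {x. P x - l *\<^sub>C x = 0}"
    using N_shift[of y l] by (simp add: N.zero)
qed

text \<open>This is the injectivity of the map that \<open>M\<close> induces between the cokernels: if \<open>M x\<close> is in the
  range of \<open>Q - l\<close>, then \<open>N (M x)\<close>, which is a nonzero multiple of \<open>x\<close> modulo the range of
  \<open>P - l\<close>, lies in that range itself. As a preimage under a continuous map, the range of \<open>P - l\<close>
  is closed if that of \<open>Q - l\<close> is.\<close>

lemma range_shift:
  assumes "l \<noteq> 0"
  shows "range (\<lambda>x. P x - l *\<^sub>C x) = M -` range (\<lambda>y. Q y - l *\<^sub>C y)"
proof (intro equalityI subsetI)
  fix x assume "x \<in> range (\<lambda>x. P x - l *\<^sub>C x)"
  then show "x \<in> M -` range (\<lambda>y. Q y - l *\<^sub>C y)"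
    using M_shift by auto
next
  fix x assume "x \<in> M -` range (\<lambda>y. Q y - l *\<^sub>C y)"
  then obtain y where y: "M x = Q y - l *\<^sub>C y" by auto
  obtain w where w: "x = N (inverse (l ^ n) *\<^sub>C M x) + (P w - l *\<^sub>C w)"
    using eq_N_M_modulo_range[OF assms] by blast
  let ?v = "inverse (l ^ n) *\<^sub>C N y + w"
  have "N (inverse (l ^ n) *\<^sub>C M x) = inverse (l ^ n) *\<^sub>C (P (N y) - l *\<^sub>C N y)"
    by (simp only: N.scaleC y N_shift)
  with w have "x = inverse (l ^ n) *\<^sub>C (P (N y) - l *\<^sub>C N y) + (P w - l *\<^sub>C w)"
    by simp
  also have "\<dots> = P ?v - l *\<^sub>C ?v"
    by (simp add: P.add P.scaleC scaleC_add_right scaleC_scaleC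
        complex_vector.scale_right_diff_distrib mult.commute)
  finally show "x \<in> range (\<lambda>x. P x - l *\<^sub>C x)" by blast
qed

lemma bounded_clinear_shift: "bounded_clinear (\<lambda>x. P x - l *\<^sub>C x)"
  by (intro bounded_clinear_sub bounded_clinear_scaleC P.bounded_clinear_axioms)

lemma upper_semi_fredholm_shift:
  assumes "l \<noteq> 0" and upper: "upper_semi_fredholm (\<lambda>y. Q y - l *\<^sub>C y)"
  shows "upper_semi_fredholm (\<lambda>x. P x - l *\<^sub>C x)"
  unfolding upper_semi_fredholm_def
proof (intro conjI bounded_clinear_shift)
  show "closed (range (\<lambda>x. P x - l *\<^sub>C x))"
    unfolding range_shift[OF assms(1)]
    using upper by (intro continuous_closed_vimage M.isCont[OF continuous_ident])
      (simp add: upper_semi_fredholm_def)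
  obtain F where "finite F" "cspan F = {y. Q y - l *\<^sub>C y = 0}"
    using upper unfolding upper_semi_fredholm_def cfinite_dim_def by blast
  then show "cfinite_dim {x. P x - l *\<^sub>C x = 0}"
    unfolding cfinite_dim_def null_space_shift[OF assms(1)]
    by (metis N.span_image finite_imageI)
qed

text \<open>If \<open>F\<close> spans the cokernel of \<open>Q - l\<close>, then \<open>N ` F\<close> spans the cokernel of \<open>P - l\<close>, because
  \<open>N\<close> induces a surjection between the cokernels.\<close>

lemma lower_semi_fredholm_shift:
  assumes "l \<noteq> 0" and lower: "lower_semi_fredholm (\<lambda>y. Q y - l *\<^sub>C y)"
  shows "lower_semi_fredholm (\<lambda>x. P x - l *\<^sub>C x)"
  unfolding lower_semi_fredholm_def
proof (intro conjI bounded_clinear_shift)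
  obtain F where F: "finite F" "\<And>y. \<exists>z\<in>cspan F. y - z \<in> range (\<lambda>y. Q y - l *\<^sub>C y)"
    using lower unfolding lower_semi_fredholm_def cfinite_codim_def by blast
  have "\<exists>z\<in>cspan (N ` F). x - z \<in> range (\<lambda>x. P x - l *\<^sub>C x)" for x
  proof -
    obtain w where w: "x = N (inverse (l ^ n) *\<^sub>C M x) + (P w - l *\<^sub>C w)"
      using eq_N_M_modulo_range[OF assms(1)] by blast
    obtain z v where z: "z \<in> cspan F" "inverse (l ^ n) *\<^sub>C M x - z = Q v - l *\<^sub>C v"
      using F(2)[of "inverse (l ^ n) *\<^sub>C M x"] by auto
    have "x - N z = N (inverse (l ^ n) *\<^sub>C M x - z) + (P w - l *\<^sub>C w)"
      using w by (simp add: N.diff)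
    also have "\<dots> = P (N v + w) - l *\<^sub>C (N v + w)"
      by (simp add: z(2) N_shift P.add scaleC_add_right)
    finally have "x - N z \<in> range (\<lambda>x. P x - l *\<^sub>C x)" by blast
    moreover have "N z \<in> cspan (N ` F)"
      using z(1) by (simp add: N.span_image)
    ultimately show ?thesis by blast
  qed
  with F(1) show "cfinite_codim (range (\<lambda>x. P x - l *\<^sub>C x))"
    unfolding cfinite_codim_def by (meson finite_imageI)
qed

end

theorem proposition4p7:
  fixes A :: "'x::complex_banach \<Rightarrow> 'y::complex_banach"
    and B C :: "'y \<Rightarrow> 'x"
  assumes "bounded_clinear A" and "bounded_clinear B" and "bounded_clinear C"
    and "A \<circ> (B \<circ> A) ^^ 2 = A \<circ> B \<circ> A \<circ> C \<circ> A"
    and "A \<circ> B \<circ> A \<circ> C \<circ> A = A \<circ> C \<circ> A \<circ> B \<circ> A"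
    and "A \<circ> C \<circ> A \<circ> B \<circ> A = (A \<circ> C) ^^ 2 \<circ> A"
  shows "(upper_semi_fredholm (\<lambda>y. (A \<circ> C) y - y) \<longleftrightarrow> upper_semi_fredholm (\<lambda>x. (B \<circ> A) x - x)) \<and>
    (lower_semi_fredholm (\<lambda>y. (A \<circ> C) y - y) \<longleftrightarrow> lower_semi_fredholm (\<lambda>x. (B \<circ> A) x - x)) \<and>
    sigma_uf (A \<circ> C) - {0} = sigma_uf (B \<circ> A) - {0} \<and>
    sigma_lf (A \<circ> C) - {0} = sigma_lf (B \<circ> A) - {0}"
proof -
  have ABACA: "A (B (A (C (A x)))) = A (B (A (B (A x))))" for x
    using fun_cong[OF assms(4), of x] by (simp add: numeral_2_eq_2)
  have ACABA: "A (C (A (B (A x)))) = A (B (A (B (A x))))" for x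
    using fun_cong[OF assms(5), of x] ABACA by simp
  have ACACA: "A (C (A (C (A x)))) = A (B (A (B (A x))))" for x
    using fun_cong[OF assms(6), of x] ACABA by (simp add: numeral_2_eq_2)
  note comp = bounded_clinear_compose
  have BA: "bounded_clinear (\<lambda>x. B (A x))" and AC: "bounded_clinear (\<lambda>y. A (C y))"
    by (rule comp[OF assms(2) assms(1)], rule comp[OF assms(1) assms(3)])
  have ACA: "bounded_clinear (\<lambda>x. A (C (A x)))"
    by (rule comp[OF AC assms(1)])
  have BABAC: "bounded_clinear (\<lambda>y. B (A (B (A (C y)))))"
    by (rule comp[OF BA comp[OF assms(2) AC]])
  \<comment> \<open>The hypotheses rewrite only words of five letters that begin and end with \<open>A\<close>. The shorter
    candidates \<open>A\<close> and \<open>BAC\<close> for \<open>M\<close> and \<open>N\<close> would not leave such a word on both sides of the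
    intertwining relations; \<open>ACA\<close> and \<open>BABAC\<close> do.\<close>
  have M_BA: "A (C (A (B (A x)))) = A (C (A (C (A x))))" for x
    by (simp add: ACABA ACACA)
  have N_AC: "B (A (B (A (C (A (C y)))))) = B (A (B (A (B (A (C y))))))" for y
    by (simp add: ABACA)
  have NM: "B (A (B (A (C (A (C (A x))))))) = ((\<lambda>x. B (A x)) ^^ 4) x" for x
    by (simp add: numeral_eq_Suc ABACA)
  have MN: "A (C (A (B (A (B (A (C y))))))) = ((\<lambda>y. A (C y)) ^^ 4) y" for y
    by (simp add: numeral_eq_Suc ACABA ACACA)
  interpret BA: intertwined "\<lambda>x. B (A x)" "\<lambda>y. A (C y)"
      "\<lambda>x. A (C (A x))" "\<lambda>y. B (A (B (A (C y))))" 4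
    by (rule intertwined.intro[OF BA AC ACA BABAC
          intertwined_axioms.intro[OF M_BA N_AC NM]])
  interpret AC: intertwined "\<lambda>y. A (C y)" "\<lambda>x. B (A x)"
      "\<lambda>y. B (A (B (A (C y))))" "\<lambda>x. A (C (A x))" 4
    by (rule intertwined.intro[OF AC BA BABAC ACA
          intertwined_axioms.intro[OF N_AC M_BA MN]])
  have upper: "upper_semi_fredholm (\<lambda>y. A (C y) - l *\<^sub>C y) \<longleftrightarrow>
      upper_semi_fredholm (\<lambda>x. B (A x) - l *\<^sub>C x)" if "l \<noteq> 0" for l
    using that AC.upper_semi_fredholm_shift BA.upper_semi_fredholm_shift by blast
  have lower: "lower_semi_fredholm (\<lambda>y. A (C y) - l *\<^sub>C y) \<longleftrightarrow>
      lower_semi_fredholm (\<lambda>x. B (A x) - l *\<^sub>C x)" if "l \<noteq> 0" for l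
    using that AC.lower_semi_fredholm_shift BA.lower_semi_fredholm_shift by blast
  show ?thesis
    using upper[of 1] lower[of 1] upper lower by (auto simp: sigma_uf_def sigma_lf_def)
qed

end
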